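(* Let $\{\psi_c\}_{c>0}$ be the cyclic flow on the space $Z\times[0,q(\cdot))=\{(z,v):z\in Z,\ 0\le v<q(z)\}$ given by $$\psi_c(z,v)=(z,\{v+\ln c\}_{q(z)}),\quad c>0,$$ where $q(z)>0$ is a measurable function on $Z$, and let $\{g_c\}_{c>0}$ be a $1$-semi-additive functional for the flow $\{\psi_c\}_{c>0}$, i.e. a measurable function $g_c(z,v):(0,\infty)\times(Z\times[0,q(\cdot)))\to\mathbb{R}$ such that $$g_{c_1c_2}(z,v)=\frac{g_{c_1}(z,v)}{c_2}+g_{c_2}(\psi_{c_1}(z,v))$$ for all $c_1,c_2>0$ and $(z,v)\in Z\times[0,q(\cdot))$. Then there is a function $g:Z\times[0,q(\cdot))\to\mathbb{R}$ such that $$g_c(z,v)=g(z,\{v+\ln c\}_{q(z)})-c^{-1}g(z,v)$$ for all $c>0$ and $(z,v)\in Z\times[0,q(\cdot))$.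
   Context: For $v\in\mathbb{R}$ and $a>0$: $[v]_a=\max\{n\in\mathbb{Z}:na\le v\}$ and $\{v\}_a=v-a[v]_a$. The space $Z\times[0,q(\cdot))$ carries the measure $\sigma(dz)dv$, where $(Z,\mathcal{Z},\sigma)$ is a standard Lebesgue space (standard Borel space with a $\sigma$-finite measure). *)

theory Defs
  imports "HOL-Analysis.Analysis"
begin

definition standard_borel_space :: "'z measure \<Rightarrow> bool" where
  "standard_borel_space M \<longleftrightarrow>
     (\<exists>T. topspace T = space M \<and> completely_metrizable_space T \<and> second_countable T \<and>
          sets M = sigma_sets (space M) {U. openin T U})"

definition standard_lebesgue_space :: "'z measure \<Rightarrow> bool" where
  "standard_lebesgue_space M \<longleftrightarrow> standard_borel_space M \<and> sigma_finite_measure M"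

text \<open>\<open>int_part a v\<close> is $[v]_a$ and \<open>frac_part a v\<close> is $\{v\}_a$; both are meant for \<open>a > 0\<close>,
  where the maximum exists.\<close>

definition int_part :: "real \<Rightarrow> real \<Rightarrow> int" where
  "int_part a v = (GREATEST n::int. of_int n * a \<le> v)"

definition frac_part :: "real \<Rightarrow> real \<Rightarrow> real" where
  "frac_part a v = v - a * of_int (int_part a v)"

lemma int_part_eq_floor:
  assumes "a > 0"
  shows "int_part a v = \<lfloor>v / a\<rfloor>"
  unfolding int_part_def
proof (rule Greatest_equality)
  show "of_int \<lfloor>v / a\<rfloor> * a \<le> v"
    using assms of_int_floor_le[of "v / a"] by (simp only: pos_le_divide_eq)
next
  fix n :: int
  assume "of_int n * a \<le> v"
  then show "n \<le> \<lfloor>v / a\<rfloor>"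
    using assms by (simp add: le_floor_iff pos_le_divide_eq)
qed

text \<open>The set $Z\times[0,q(\cdot))$ with the measure $\sigma(dz)\,dv$.\<close>

definition cyclic_space :: "'z measure \<Rightarrow> ('z \<Rightarrow> real) \<Rightarrow> ('z \<times> real) measure" where
  "cyclic_space \<sigma> q =
     restrict_space (\<sigma> \<Otimes>\<^sub>M lborel) {(z, v). z \<in> space \<sigma> \<and> 0 \<le> v \<and> v < q z}"

lemma space_cyclic_space:
  "space (cyclic_space \<sigma> q) = {(z, v). z \<in> space \<sigma> \<and> 0 \<le> v \<and> v < q z}"
  by (auto simp: cyclic_space_def space_restrict_space space_pair_measure)

definition cyclic_flow :: "('z \<Rightarrow> real) \<Rightarrow> real \<Rightarrow> 'z \<times> real \<Rightarrow> 'z \<times> real" where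
  "cyclic_flow q c = (\<lambda>(z, v). (z, frac_part (q z) (v + ln c)))"

text \<open>Flows and functionals are indexed by the multiplicative group \<open>c > 0\<close>; values at
  \<open>c \<le> 0\<close> are never constrained.\<close>

definition one_semi_additive_functional ::
    "'x measure \<Rightarrow> (real \<Rightarrow> 'x \<Rightarrow> 'x) \<Rightarrow> (real \<Rightarrow> 'x \<Rightarrow> real) \<Rightarrow> bool" where
  "one_semi_additive_functional X \<psi> g \<longleftrightarrow>
     (\<lambda>(c, x). g c x) \<in> borel_measurable (restrict_space borel {0<..} \<Otimes>\<^sub>M X) \<and>
     (\<forall>c1>0. \<forall>c2>0. \<forall>x\<in>space X. g (c1 * c2) x = g c1 x / c2 + g c2 (\<psi> c1 x))"

end

theory Submission
  imports Defs
begin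

text \<open>The flow has period \<open>p = exp (q z)\<close> on the fibre over \<open>z\<close>. Expanding \<open>gc (p * c) x = gc (c * p) x\<close> by
  semi-additivity in both orders gives
  \<open>gc p x / c + gc c x = gc c x / p + gc p (\<psi> c x)\<close>, so \<open>g x = gc p x / (1 - 1 / p)\<close> solves the equation.\<close>

text \<open>As \<open>v\<close> lies in the fundamental interval, reduction modulo \<open>a\<close>
  strips exactly the one added period.\<close>

lemma frac_part_period:
  assumes "0 \<le> v" "v < a"
  shows "frac_part a (v + a) = v"
proof -
  have "a > 0" using assms by simp
  moreover have "\<lfloor>(v + a) / a\<rfloor> = 1"
    using assms by (intro floor_unique) (auto simp: field_simps)
  ultimately show ?thesis
    by (simp add: frac_part_def int_part_eq_floor)
qed

text \<open>Stated pointwise: \<open>\<psi> p\<close> has to fix only this \<open>x\<close>, so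
  \<open>p\<close> may vary from fibre to fibre, as \<open>exp (q z)\<close> does.\<close>

lemma semi_additive_coboundary:
  assumes X: "one_semi_additive_functional X \<psi> gc" "x \<in> space X"
    and p: "p > 1" "\<psi> p x = x" and c: "c > 0"
  shows "gc c x = gc p (\<psi> c x) / (1 - 1 / p) - inverse c * (gc p x / (1 - 1 / p))"
proof -
  have "gc (p * c) x = gc p x / c + gc c x" "gc (c * p) x = gc c x / p + gc p (\<psi> c x)"
    using X p c by (auto simp: one_semi_additive_functional_def)
  then have "gc c x * (1 - 1 / p) = gc p (\<psi> c x) - inverse c * gc p x"
    by (simp add: mult.commute algebra_simps divide_inverse)
  moreover have "1 - 1 / p \<noteq> 0" using p by simp
  ultimately have "gc c x = (gc p (\<psi> c x) - inverse c * gc p x) / (1 - 1 / p)"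
    by (intro eq_divide_imp)
  then show ?thesis
    by (simp only: diff_divide_distrib times_divide_eq_right)
qed

theorem proposition5p1:
  fixes \<sigma> :: "'z measure"
    and q :: "'z \<Rightarrow> real"
    and gc :: "real \<Rightarrow> 'z \<times> real \<Rightarrow> real"
  assumes "standard_lebesgue_space \<sigma>"
    and "q \<in> borel_measurable \<sigma>"
    and "\<And>z. z \<in> space \<sigma> \<Longrightarrow> q z > 0"
    and "one_semi_additive_functional (cyclic_space \<sigma> q) (cyclic_flow q) gc"
  shows "\<exists>g :: 'z \<times> real \<Rightarrow> real.
    \<forall>c>0. \<forall>(z, v) \<in> space (cyclic_space \<sigma> q).
      gc c (z, v) = g (z, frac_part (q z) (v + ln c)) - inverse c * g (z, v)"
proof -
  \<comment> \<open>The period depends on \<open>z\<close> alone and the flow preserves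
    \<open>z\<close>, so \<open>g\<close> uses the same \<open>p\<close> at a point and at its
    image.\<close>
  define g where "g = (\<lambda>(z, v). gc (exp (q z)) (z, v) / (1 - 1 / exp (q z)))"
  have "gc c (z, v) = g (z, frac_part (q z) (v + ln c)) - inverse c * g (z, v)"
    if c: "c > 0" and zv: "(z, v) \<in> space (cyclic_space \<sigma> q)" for c z v
  proof -
    have "0 \<le> v" "v < q z" using zv by (auto simp: space_cyclic_space)
    \<comment> \<open>Time \<open>exp (q z)\<close> shifts \<open>v\<close> by
      \<open>ln (exp (q z)) = q z\<close>, one full turn; \<open>0 \<le> v < q z\<close> forces
      \<open>q z > 0\<close>.\<close>
    then have "cyclic_flow q (exp (q z)) (z, v) = (z, v)" "exp (q z) > 1"
      by (auto simp: cyclic_flow_def frac_part_period)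
    from semi_additive_coboundary[OF assms(4) zv this(2,1) c] show ?thesis
      by (simp add: cyclic_flow_def g_def)
  qed
  then show ?thesis by blast
qed

end
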